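(* Let $\mathcal{X}=\{\pmb{x}\in\{0,1\}^n:\pmb{A}\pmb{x}\ge\pmb{b}\}$, $\alpha\in(0,1]$, $q\in[1,\infty]$ with dual exponent $q'$ ($\frac1q+\frac1{q'}=1$), and $\gamma=\min\{N,\frac1\alpha\}$. If the problem $$\min_{\pmb{x}\in\mathcal{X}}\ {\rm E}_{\widehat{\mathbb{P}}^N}[\tilde{\pmb{\xi}}^T\pmb{x}]+\epsilon\|\pmb{x}\|_{q'}$$ can be solved in polynomial time, then the problem $$\min_{\pmb{x}\in\mathcal{X}}\ {\rm CVaR}^{\alpha}_{\widehat{\mathbb{P}}^N}[\tilde{\pmb{\xi}}^T\pmb{x}]+\gamma\,\epsilon\,\|\pmb{x}\|_{q'}$$ is approximable within $\gamma$.
   Context: $\hat{\pmb{\xi}}_1,\dots,\hat{\pmb{\xi}}_N\in\mathbb{R}^n_+$ is a given sample, $\widehat{\mathbb{P}}^N=\frac1N\sum_{i=1}^N\delta_{\hat{\pmb{\xi}}_i}$ is the empirical distribution, $\epsilon\ge0$, and $\tilde{\pmb{\xi}}$ is a random vector with distribution $\widehat{\mathbb{P}}^N$; thus ${\rm E}_{\widehat{\mathbb{P}}^N}[\tilde{\pmb{\xi}}^T\pmb{x}]=\frac1N\sum_{i=1}^N\hat{\pmb{\xi}}_i^T\pmb{x}$ and ${\rm CVaR}^{\alpha}_{\widehat{\mathbb{P}}^N}[\tilde{\pmb{\xi}}^T\pmb{x}]=\inf_{t\in\mathbb{R}}\big(t+\frac1{\alpha N}\sum_{i=1}^N\max\{0,\hat{\pmb{\xi}}_i^T\pmb{x}-t\}\big)$.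 $\|\cdot\|_{q'}$ is the $q'$-norm. A minimization problem is approximable within $\rho\ge1$ if there is a polynomial-time algorithm which always outputs a feasible solution whose objective value is at most $\rho$ times the optimal value.
   Formalization: The sample vectors, A, b and ε are taken to be rational, since polynomial time on a Turing machine is undefined for arbitrary real input data; α and q stay arbitrary fixed reals (q possibly infinite), and an algorithm may report that the feasible set is empty. *)

theory Defs
  imports
    "HOL-Probability.Probability"
    "HOL-Library.Log_Nat"
    "HOL-Computational_Algebra.Polynomial"
    "Jordan_Normal_Form.Matrix"
begin

unbundle no inner_syntax
unbundle no vec_syntax
hide_type (open) Finite_Cartesian_Product.vec

section \<open>Empirical distribution, CVaR and norms\<close>

definition empirical :: "'a list \<Rightarrow> 'a pmf" where
  "empirical \<xi>s = map_pmf (\<lambda>i. \<xi>s ! i) (pmf_of_set {..<length \<xi>s})"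

definition cvar :: "real \<Rightarrow> 'a pmf \<Rightarrow> ('a \<Rightarrow> real) \<Rightarrow> real" where
  "cvar \<alpha> P f = (INF t. t + 1 / \<alpha> * measure_pmf.expectation P (\<lambda>\<omega>. max 0 (f \<omega> - t)))"

definition pnorm :: "ennreal \<Rightarrow> real vec \<Rightarrow> real" where
  "pnorm p x =
     (if p = \<infinity> then Max {\<bar>x $ j\<bar> | j. j < dim_vec x}
      else (\<Sum>j<dim_vec x. \<bar>x $ j\<bar> powr enn2real p) powr (1 / enn2real p))"

lemma expectation_empirical:
  assumes "\<xi>s \<noteq> []"
  shows "measure_pmf.expectation (empirical \<xi>s) f
    = 1 / real (length \<xi>s) * (\<Sum>i<length \<xi>s. f (\<xi>s ! i) :: real)"
  using assms by (subst empirical_def) (simp add: integral_pmf_of_set lessThan_empty_iff)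

lemma cvar_empirical:
  assumes "\<xi>s \<noteq> []"
  shows "cvar \<alpha> (empirical \<xi>s) f
    = (INF t. t + 1 / (\<alpha> * real (length \<xi>s)) * (\<Sum>i<length \<xi>s. max 0 (f (\<xi>s ! i) - t)))"
  by (simp add: cvar_def expectation_empirical[OF assms])


section \<open>Deterministic Turing machines\<close>

text \<open>
  One two-way infinite tape. State 0 is initial and state 1 is halting; tape symbol 0 is the
  blank, and 1, 2 stand for the bits \<open>False\<close>, \<open>True\<close>.
\<close>

record turing_machine =
  num_states :: nat
  num_symbols :: nat
  transition :: "nat \<Rightarrow> nat \<Rightarrow> nat \<times> nat \<times> int"

definition wf_tm :: "turing_machine \<Rightarrow> bool" where
  "wf_tm M \<longleftrightarrow> 2 \<le> num_states M \<and> 3 \<le> num_symbols M \<and>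
     (\<forall>q<num_states M. \<forall>s<num_symbols M.
        transition M q s \<in> {..<num_states M} \<times> {..<num_symbols M} \<times> {-1, 0, 1})"

type_synonym config = "nat \<times> int \<times> (int \<Rightarrow> nat)"

fun tm_step :: "turing_machine \<Rightarrow> config \<Rightarrow> config" where
  "tm_step M (q, h, tape) =
     (if q = 1 then (q, h, tape)
      else let (q', s, d) = transition M q (tape h) in (q', h + d, tape(h := s)))"

definition word_tape :: "bool list \<Rightarrow> int \<Rightarrow> nat" where
  "word_tape w i =
     (if 0 \<le> i \<and> i < int (length w) then (if w ! nat i then 2 else 1) else 0)"

text \<open>The output is the word that starts at cell 0 and extends to the first blank.\<close>

definition tm_outputs :: "turing_machine \<Rightarrow> bool list \<Rightarrow> nat \<Rightarrow> bool list \<Rightarrow> bool" where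
  "tm_outputs M u t w \<longleftrightarrow>
     (case (tm_step M ^^ t) (0, 0, word_tape u) of (q, h, tape) \<Rightarrow>
        q = 1 \<and> (\<forall>i\<in>{0..int (length w)}. tape i = word_tape w i))"

text \<open>
  Some polynomial-time machine answers every instance of \<open>K\<close>: from the code of \<open>I\<close> it computes
  the code of an answer \<open>a\<close> with \<open>R I a\<close>. As usual for promise problems, nothing is required
  on words that do not encode an instance of \<open>K\<close>.
\<close>

definition polytime_search ::
  "('i \<Rightarrow> bool list) \<Rightarrow> ('a \<Rightarrow> bool list) \<Rightarrow> 'i set \<Rightarrow> ('i \<Rightarrow> 'a \<Rightarrow> bool) \<Rightarrow> bool" where
  "polytime_search enc_in enc_out K R \<longleftrightarrow>
     (\<exists>M. \<exists>p :: nat poly. wf_tm M \<and>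
        (\<forall>I\<in>K. \<exists>a. \<exists>t \<le> poly p (length (enc_in I)).
           R I a \<and> tm_outputs M (enc_in I) t (enc_out a)))"


section \<open>Instances and their binary encoding\<close>

text \<open>
  The input of the algorithms: the constraints \<open>A x \<ge> b\<close>, the sample and the radius \<open>\<epsilon>\<close>. The
  data are rational so that a Turing machine can read them; the exponent of the norm and the
  CVaR level are fixed parameters that are not part of the input. The order on \<open>vec\<close> includes equality
  of dimensions.
\<close>

record robust_data =
  lhs :: "rat mat"
  rhs :: "rat vec"
  sample :: "rat vec list"
  radius :: rat

definition wf_data :: "robust_data \<Rightarrow> bool" where
  "wf_data I \<longleftrightarrow> 0 < dim_col (lhs I) \<and> dim_vec (rhs I) = dim_row (lhs I) \<and>
     sample I \<noteq> [] \<and> (\<forall>\<xi>\<in>set (sample I). 0\<^sub>v (dim_col (lhs I)) \<le> \<xi>) \<and> 0 \<le> radius I"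

definition word_code :: "bool list \<Rightarrow> bool list" where
  "word_code w = concat (map (\<lambda>c. [True, c]) w) @ [False]"

definition nat_code :: "nat \<Rightarrow> bool list" where
  "nat_code k = word_code (map (bit k) [0..<floorlog 2 k])"

definition rat_code :: "rat \<Rightarrow> bool list" where
  "rat_code r = (case quotient_of r of (c, d) \<Rightarrow>
     (c < 0) # nat_code (nat \<bar>c\<bar>) @ nat_code (nat d))"

definition data_code :: "robust_data \<Rightarrow> bool list" where
  "data_code I =
     nat_code (dim_row (lhs I)) @ nat_code (dim_col (lhs I)) @ nat_code (length (sample I)) @
     concat (map rat_code
       (concat (map list_of_vec (rows (lhs I) @ rhs I # sample I)) @ [radius I]))"

text \<open>An answer is a 0-1 vector, or \<open>None\<close> to report that there is no feasible solution.\<close>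

fun answer_code :: "real vec option \<Rightarrow> bool list" where
  "answer_code None = [False]"
| "answer_code (Some x) = True # map (\<lambda>c. c = 1) (list_of_vec x)"

lemma word_code_append_eq:
  "word_code u @ y = word_code v @ z \<longleftrightarrow> u = v \<and> y = z"
proof (induction u arbitrary: v)
  case Nil
  then show ?case by (cases v) (auto simp: word_code_def)
next
  case (Cons c u)
  then show ?case by (cases v) (auto simp: word_code_def)
qed

lemma nat_code_append_eq: "nat_code k @ y = nat_code l @ z \<longleftrightarrow> k = l \<and> y = z"
proof -
  have val: "horner_sum of_bool 2 (map (bit k) [0..<floorlog 2 k]) = k" for k :: nat
  proof -
    have "k < 2 ^ floorlog 2 k"
      using floorlog_bounds[of k 2] by (cases "k = 0") auto
    then show ?thesis
      by (simp only: horner_sum_bit_eq_take_bit take_bit_nat_eq_self)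
  qed
  have "map (bit k) [0..<floorlog 2 k] = map (bit l) [0..<floorlog 2 l] \<Longrightarrow> k = l"
    by (metis val)
  then show ?thesis
    unfolding nat_code_def word_code_append_eq by blast
qed

lemma rat_code_append_eq: "rat_code r @ y = rat_code s @ z \<longleftrightarrow> r = s \<and> y = z"
proof -
  obtain a b where r: "quotient_of r = (a, b)" by (cases "quotient_of r")
  obtain c d where s: "quotient_of s = (c, d)" by (cases "quotient_of s")
  have "b > 0" "d > 0" using quotient_of_denom_pos r s by auto
  moreover have "r = s \<longleftrightarrow> a = c \<and> b = d"
    using r s quotient_of_inject_eq by (metis prod.inject)
  ultimately show ?thesis
    by (auto simp: rat_code_def r s nat_code_append_eq)
qed

lemma rat_codes_inject:
  "length rs = length ss \<Longrightarrow> concat (map rat_code rs) = concat (map rat_code ss) \<Longrightarrow> rs = ss"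
  by (induction rs ss rule: list_induct2) (simp_all add: rat_code_append_eq)

lemma concat_same_lengths:
  "map length xss = map length yss \<Longrightarrow> concat xss = concat yss \<Longrightarrow> xss = yss"
proof (induction xss arbitrary: yss)
  case (Cons xs xss)
  then show ?case by (cases yss) auto
qed simp

lemma data_code_inject:
  assumes "wf_data I" "wf_data J" "data_code I = data_code J"
  shows "I = J"
proof -
  let ?vs = "\<lambda>I. rows (lhs I) @ rhs I # sample I"
  define m n where "m = dim_row (lhs I)" and "n = dim_col (lhs I)"
  have dims: "dim_row (lhs J) = m" "dim_col (lhs J) = n" "length (sample J) = length (sample I)"
    and codes: "concat (map rat_code (concat (map list_of_vec (?vs I)) @ [radius I]))
      = concat (map rat_code (concat (map list_of_vec (?vs J)) @ [radius J]))"
    using assms(3) unfolding data_code_def nat_code_append_eq m_def n_def by simp_all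
  have len: "map dim_vec (?vs K) = replicate m n @ m # replicate (length (sample I)) n"
    if "K = I \<or> K = J" for K
  proof -
    have K: "wf_data K" "dim_row (lhs K) = m" "dim_col (lhs K) = n"
      "length (sample K) = length (sample I)"
      using that assms dims by (auto simp: m_def n_def)
    have "map dim_vec (rows (lhs K)) = replicate m n"
      by (rule nth_equalityI) (simp_all add: K)
    moreover have "\<forall>\<xi>\<in>set (sample K). dim_vec \<xi> = n"
      using K by (auto simp: wf_data_def less_eq_vec_def)
    then have "map dim_vec (sample K) = replicate (length (sample I)) n"
      by (intro nth_equalityI) (simp_all add: K)
    ultimately show ?thesis using K by (simp add: wf_data_def)
  qed
  have lens: "map dim_vec (?vs I) = map dim_vec (?vs J)"
    using len[of I] len[of J] by simp
  have lens': "map length (map list_of_vec (?vs I)) = map length (map list_of_vec (?vs J))"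
    using lens by (simp add: comp_def)
  then have "concat (map list_of_vec (?vs I)) @ [radius I]
      = concat (map list_of_vec (?vs J)) @ [radius J]"
    using codes by (intro rat_codes_inject) (simp_all only: length_concat length_append, simp)
  then have rad: "radius I = radius J"
    and eq: "concat (map list_of_vec (?vs I)) = concat (map list_of_vec (?vs J))"
    by simp_all
  have "map list_of_vec (?vs I) = map list_of_vec (?vs J)"
    by (rule concat_same_lengths[OF lens' eq])
  then have "?vs I = ?vs J"
    by (metis list.inj_map_strong vec_list)
  then have "rows (lhs I) = rows (lhs J)" "rhs I = rhs J" "sample I = sample J"
    using dims by (auto simp: append_eq_append_conv m_def)
  moreover have "lhs I = lhs J"
    using calculation(1) dims mat_of_rows_rows[of "lhs I"] mat_of_rows_rows[of "lhs J"]
    by (simp add: m_def n_def)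
  ultimately show ?thesis using rad by (intro robust_data.equality) simp_all
qed


section \<open>Minimization problems\<close>

definition solvable_in_polytime ::
  "robust_data set \<Rightarrow> (robust_data \<Rightarrow> real vec set) \<Rightarrow> (robust_data \<Rightarrow> real vec \<Rightarrow> real) \<Rightarrow> bool" where
  "solvable_in_polytime K feas cost \<longleftrightarrow>
     polytime_search data_code answer_code K
       (\<lambda>I a. case a of
          None \<Rightarrow> feas I = {}
        | Some x \<Rightarrow> is_arg_min (cost I) (\<lambda>x. x \<in> feas I) x)"

definition approximable_within ::
  "robust_data set \<Rightarrow> (robust_data \<Rightarrow> real vec set) \<Rightarrow> (robust_data \<Rightarrow> real vec \<Rightarrow> real) \<Rightarrow>
     (robust_data \<Rightarrow> real) \<Rightarrow> bool" where
  "approximable_within K feas cost \<rho> \<longleftrightarrow>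
     (\<forall>I\<in>K. 1 \<le> \<rho> I) \<and>
     polytime_search data_code answer_code K
       (\<lambda>I a. case a of
          None \<Rightarrow> feas I = {}
        | Some x \<Rightarrow> x \<in> feas I \<and> cost I x \<le> \<rho> I * (INF y\<in>feas I. cost I y))"

definition real_sample :: "robust_data \<Rightarrow> real vec list" where
  "real_sample I = map (map_vec of_rat) (sample I)"

definition feasible :: "robust_data \<Rightarrow> real vec set" where
  "feasible I = {x \<in> carrier_vec (dim_col (lhs I)).
     (\<forall>j<dim_col (lhs I). x $ j \<in> {0, 1}) \<and>
     map_mat of_rat (lhs I) *\<^sub>v x \<ge> map_vec of_rat (rhs I)}"

definition mean_cost :: "ennreal \<Rightarrow> robust_data \<Rightarrow> real vec \<Rightarrow> real" where
  "mean_cost q' I x =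
     measure_pmf.expectation (empirical (real_sample I)) (\<lambda>\<xi>. \<xi> \<bullet> x)
       + of_rat (radius I) * pnorm q' x"

definition cvar_cost :: "real \<Rightarrow> (robust_data \<Rightarrow> real) \<Rightarrow> ennreal \<Rightarrow> robust_data \<Rightarrow> real vec \<Rightarrow> real" where
  "cvar_cost \<alpha> \<gamma> q' I x =
     cvar \<alpha> (empirical (real_sample I)) (\<lambda>\<xi>. \<xi> \<bullet> x)
       + \<gamma> I * of_rat (radius I) * pnorm q' x"

end

theory Submission
  imports Defs
begin

text \<open>
  On nonnegative data the mean and the CVaR satisfy E \<open>\<le>\<close> CVaR \<open>\<le>\<close> \<open>\<gamma>\<close> E. The upper bound comes
  from evaluating the infimum at \<open>t = 0\<close>, which gives the factor \<open>1 / \<alpha>\<close>, and at \<open>t\<close> the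
  sum of all sample values, which gives the factor \<open>N\<close>. Hence a minimizer of the mean problem
  is itself a \<open>\<gamma>\<close>-approximate minimizer of the CVaR problem, and the algorithm for the former
  can be used unchanged.
\<close>

text \<open>The same machine, polynomial, answers and running times serve for \<open>S\<close>,
  because the relation constrains only the answer.\<close>

lemma polytime_search_mono:
  assumes "polytime_search enc_in enc_out K R"
    and "\<And>I a. I \<in> K \<Longrightarrow> R I a \<Longrightarrow> S I a"
  shows "polytime_search enc_in enc_out K S"
  using assms unfolding polytime_search_def by meson

text \<open>Positive dimension matters for p = \<infinity>, where an empty \<open>Max\<close> would
  be unspecified.\<close>

lemma pnorm_nonneg:
  assumes "0 < dim_vec x"
  shows "0 \<le> pnorm p x"
proof (cases "p = \<infinity>")
  case True
  have "\<bar>x $ 0\<bar> \<le> Max {\<bar>x $ j\<bar> | j. j < dim_vec x}"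
    using assms by (intro Max_ge) auto
  with True show ?thesis
    by (simp add: pnorm_def)
qed (simp add: pnorm_def)

text \<open>Average v \<le> t + max 0 (v - t) over the sample values v, then enlarge the weight 1/N
  to 1/(\<alpha>N), as \<alpha> \<le> 1. Being uniform in t, the bound also shows that the infimum
  defining CVaR is over a set bounded below.\<close>

lemma expectation_le_cvar_objective:
  assumes "\<xi>s \<noteq> []" "0 < \<alpha>" "\<alpha> \<le> 1"
  shows "measure_pmf.expectation (empirical \<xi>s) f
    \<le> t + 1 / (\<alpha> * real (length \<xi>s)) * (\<Sum>i<length \<xi>s. max 0 (f (\<xi>s ! i) - t))"
proof -
  define N where "N = real (length \<xi>s)"
  have N: "0 < N" using assms by (simp add: N_def)
  define S where "S = (\<Sum>i<length \<xi>s. max 0 (f (\<xi>s ! i) - t))"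
  have "(\<Sum>i<length \<xi>s. f (\<xi>s ! i)) - N * t = (\<Sum>i<length \<xi>s. f (\<xi>s ! i) - t)"
    by (simp add: sum_subtractf N_def)
  also have "\<dots> \<le> S"
    unfolding S_def by (intro sum_mono) auto
  finally have "(\<Sum>i<length \<xi>s. f (\<xi>s ! i)) \<le> N * t + S" by simp
  then have "1 / N * (\<Sum>i<length \<xi>s. f (\<xi>s ! i)) \<le> t + 1 / N * S"
    using N by (simp add: field_simps)
  also have "1 / N * S \<le> 1 / (\<alpha> * N) * S"
  proof (rule mult_right_mono)
    show "1 / N \<le> 1 / (\<alpha> * N)"
      using N assms by (intro divide_left_mono) auto
    show "0 \<le> S" unfolding S_def by (intro sum_nonneg) simp
  qed
  finally show ?thesis
    by (simp add: expectation_empirical[OF assms(1)] N_def S_def)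
qed

lemma expectation_le_cvar:
  assumes "\<xi>s \<noteq> []" "0 < \<alpha>" "\<alpha> \<le> 1"
  shows "measure_pmf.expectation (empirical \<xi>s) f \<le> cvar \<alpha> (empirical \<xi>s) f"
  unfolding cvar_empirical[OF assms(1)]
  using expectation_le_cvar_objective[OF assms] by (intro cINF_greatest) auto

lemma cvar_le_objective:
  assumes "\<xi>s \<noteq> []" "0 < \<alpha>" "\<alpha> \<le> 1"
  shows "cvar \<alpha> (empirical \<xi>s) f
    \<le> t + 1 / (\<alpha> * real (length \<xi>s)) * (\<Sum>i<length \<xi>s. max 0 (f (\<xi>s ! i) - t))"
  unfolding cvar_empirical[OF assms(1)]
  using expectation_le_cvar_objective[OF assms] by (intro cINF_lower bdd_belowI2) auto

lemma cvar_le_expectation: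
  assumes "\<xi>s \<noteq> []" "0 < \<alpha>" "\<alpha> \<le> 1" and nonneg: "\<And>\<xi>. \<xi> \<in> set \<xi>s \<Longrightarrow> 0 \<le> f \<xi>"
  shows "cvar \<alpha> (empirical \<xi>s) f
    \<le> min (real (length \<xi>s)) (1 / \<alpha>) * measure_pmf.expectation (empirical \<xi>s) f"
proof -
  define T where "T = (\<Sum>i<length \<xi>s. f (\<xi>s ! i))"
  have f: "0 \<le> f (\<xi>s ! i)" if "i < length \<xi>s" for i
    using nonneg that by simp
  have mean: "measure_pmf.expectation (empirical \<xi>s) f = 1 / real (length \<xi>s) * T"
    by (simp add: expectation_empirical[OF assms(1)] T_def)
  \<comment> \<open>A single nonnegative summand is at most the total, so no value exceeds the
    threshold t = T and the objective there is T, which is N times the mean.\<close>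
  have "f (\<xi>s ! i) \<le> T" if "i < length \<xi>s" for i
    unfolding T_def using that f by (intro member_le_sum) auto
  then have "(\<Sum>i<length \<xi>s. max 0 (f (\<xi>s ! i) - T)) = 0"
    by (intro sum.neutral) auto
  then have "cvar \<alpha> (empirical \<xi>s) f \<le> real (length \<xi>s) * (1 / real (length \<xi>s) * T)"
    using cvar_le_objective[OF assms(1-3), of f T] assms(1) by simp
  moreover have "(\<Sum>i<length \<xi>s. max 0 (f (\<xi>s ! i) - 0)) = T"
    unfolding T_def using f by (intro sum.cong) auto
  then have "cvar \<alpha> (empirical \<xi>s) f \<le> 1 / \<alpha> * (1 / real (length \<xi>s) * T)"
    using cvar_le_objective[OF assms(1-3), of f 0] by simp
  ultimately show ?thesis
    unfolding mean by (simp add: min_def)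
qed

lemma real_sample_scalar_prod_nonneg:
  assumes "wf_data I" "x \<in> feasible I" "\<xi> \<in> set (real_sample I)"
  shows "0 \<le> \<xi> \<bullet> x"
proof -
  obtain \<zeta> where \<zeta>: "\<zeta> \<in> set (sample I)" "\<xi> = map_vec of_rat \<zeta>"
    using assms(3) by (auto simp: real_sample_def)
  \<comment> \<open>The order on vectors includes equality of dimensions, so the one inequality in
    \<open>wf_data\<close> yields both facts.\<close>
  have "dim_vec \<zeta> = dim_col (lhs I)" "\<And>j. j < dim_col (lhs I) \<Longrightarrow> 0 \<le> \<zeta> $ j"
    using assms(1) \<zeta>(1) by (auto simp: wf_data_def less_eq_vec_def)
  moreover have "dim_vec x = dim_col (lhs I)" "\<And>j. j < dim_col (lhs I) \<Longrightarrow> 0 \<le> x $ j"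
    using assms(2) by (force simp: feasible_def)+
  ultimately show ?thesis
    unfolding scalar_prod_def \<zeta>(2) by (intro sum_nonneg mult_nonneg_nonneg) auto
qed

text \<open>For every feasible y, with costs including the norm terms: CVaR cost of x \<le> \<gamma>
  * mean cost of x \<le> \<gamma> * mean cost of y \<le> \<gamma> * CVaR cost of y. The last
  inequality uses \<gamma> \<ge> 1 to absorb the nonnegative norm term.\<close>

lemma mean_minimizer_approximates_cvar:
  assumes wf: "wf_data I" and \<alpha>: "0 < \<alpha>" "\<alpha> \<le> 1"
    and \<gamma>: "\<gamma> I = min (real (length (sample I))) (1 / \<alpha>)" "1 \<le> \<gamma> I"
    and x: "is_arg_min (mean_cost p I) (\<lambda>x. x \<in> feasible I) x"
  shows "cvar_cost \<alpha> \<gamma> p I x \<le> \<gamma> I * (INF y\<in>feasible I. cvar_cost \<alpha> \<gamma> p I y)"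
proof -
  have ne: "real_sample I \<noteq> []"
    using wf by (simp add: real_sample_def wf_data_def)
  have feas: "x \<in> feasible I" and opt: "\<And>y. y \<in> feasible I \<Longrightarrow> mean_cost p I x \<le> mean_cost p I y"
    using x by (auto simp: is_arg_min_def not_less)
  have "mean_cost p I y \<le> cvar_cost \<alpha> \<gamma> p I y" if y: "y \<in> feasible I" for y
  proof -
    have "0 \<le> of_rat (radius I) * pnorm p y"
      using wf y by (auto simp: wf_data_def feasible_def intro!: mult_nonneg_nonneg pnorm_nonneg)
    then have "of_rat (radius I) * pnorm p y \<le> \<gamma> I * (of_rat (radius I) * pnorm p y)"
      using \<gamma>(2) mult_right_mono[of 1 "\<gamma> I"] by simp
    then show ?thesis
      using expectation_le_cvar[OF ne \<alpha>, of "\<lambda>\<xi>. \<xi> \<bullet> y"]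
      by (simp add: mean_cost_def cvar_cost_def mult.assoc)
  qed
  \<comment> \<open>The point x itself makes the feasible set nonempty, so a common lower bound lies
    below the infimum.\<close>
  then have "mean_cost p I x \<le> (INF y\<in>feasible I. cvar_cost \<alpha> \<gamma> p I y)"
    using feas opt by (intro cINF_greatest) (auto intro: order_trans)
  \<comment> \<open>The norm term of the CVaR cost already carries the factor \<gamma>, so only the
    CVaR term has to be estimated.\<close>
  moreover have "cvar_cost \<alpha> \<gamma> p I x \<le> \<gamma> I * mean_cost p I x"
    using cvar_le_expectation[OF ne \<alpha>, of "\<lambda>\<xi>. \<xi> \<bullet> x"]
      real_sample_scalar_prod_nonneg[OF wf feas] \<gamma>(1)
    by (simp add: mean_cost_def cvar_cost_def real_sample_def algebra_simps)
  ultimately show ?thesis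
    using \<gamma>(2) by (meson mult_left_mono order_trans zero_le_one)
qed

theorem proposition3:
  fixes K :: "robust_data set" and \<alpha> :: real and q q' :: ennreal
    and \<gamma> :: "robust_data \<Rightarrow> real"
  assumes instances: "\<forall>I\<in>K. wf_data I"
    and level: "0 < \<alpha>" "\<alpha> \<le> 1"
    and dual: "1 \<le> q" "1 / q + 1 / q' = 1"
    and gamma: "\<And>I. \<gamma> I = min (real (length (sample I))) (1 / \<alpha>)"
    and mean: "solvable_in_polytime K feasible (mean_cost q')"
  shows "approximable_within K feasible (cvar_cost \<alpha> \<gamma> q') \<gamma>"
  unfolding approximable_within_def
proof (intro conjI ballI)
  \<comment> \<open>The sample is nonempty and \<alpha> \<le> 1, so both arguments of the minimum
    are at least 1.\<close>
  show ge1: "1 \<le> \<gamma> I" if "I \<in> K" for I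
    using instances that level by (auto simp: gamma wf_data_def Suc_le_eq)
  show "polytime_search data_code answer_code K
    (\<lambda>I a. case a of
       None \<Rightarrow> feasible I = {}
     | Some x \<Rightarrow> x \<in> feasible I \<and>
         cvar_cost \<alpha> \<gamma> q' I x \<le> \<gamma> I * (INF y\<in>feasible I. cvar_cost \<alpha> \<gamma> q' I y))"
    using mean unfolding solvable_in_polytime_def
  proof (rule polytime_search_mono)
    fix I a
    assume "I \<in> K" and R: "case a of
         None \<Rightarrow> feasible I = {}
       | Some x \<Rightarrow> is_arg_min (mean_cost q' I) (\<lambda>x. x \<in> feasible I) x"
    then show "case a of
         None \<Rightarrow> feasible I = {}
       | Some x \<Rightarrow> x \<in> feasible I \<and>
           cvar_cost \<alpha> \<gamma> q' I x \<le> \<gamma> I * (INF y\<in>feasible I. cvar_cost \<alpha> \<gamma> q' I y)"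
      using mean_minimizer_approximates_cvar[of I \<alpha> \<gamma> q'] instances level gamma ge1
      by (auto simp: is_arg_min_def split: option.splits)
  qed
qed

end
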